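(* Let $R$ be a commutative ring with nonzero identity, $M$ a unitary $R$-module, and $0\neq x\in M$ such that $Rx\neq M$ and $(0:_Rx)=0$. If $Rx$ is not a prime submodule of $M$, then $Rx$ is not a $\phi_1$-prime submodule of $M$.
   Context: For a submodule $N$ of $M$, $(N:_RM)=\{r\in R: rM\subseteq N\}$, and $(0:_Rx)=\{r\in R: rx=0\}$. A proper submodule $P$ of $M$ is prime if for all $r\in R$, $y\in M$, $ry\in P$ implies $r\in(P:_RM)$ or $y\in P$. A proper submodule $P$ of $M$ is $\phi_1$-prime if for all $r\in R$, $y\in M$, $ry\in P\setminus (P:_RM)P$ implies $r\in(P:_RM)$ or $y\in P$. *)

theory Defs
  imports "HOL-Algebra.Module"
begin

definition submodule_colon ::
    "('a, 'c) ring_scheme \<Rightarrow> ('a, 'b, 'd) module_scheme \<Rightarrow> 'b set \<Rightarrow> 'a set"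
  where "submodule_colon R M N = {r \<in> carrier R. \<forall>m \<in> carrier M. r \<odot>\<^bsub>M\<^esub> m \<in> N}"

definition elt_annihilator ::
    "('a, 'c) ring_scheme \<Rightarrow> ('a, 'b, 'd) module_scheme \<Rightarrow> 'b \<Rightarrow> 'a set"
  where "elt_annihilator R M x = {r \<in> carrier R. r \<odot>\<^bsub>M\<^esub> x = \<zero>\<^bsub>M\<^esub>}"

definition cyclic_submodule ::
    "('a, 'c) ring_scheme \<Rightarrow> ('a, 'b, 'd) module_scheme \<Rightarrow> 'b \<Rightarrow> 'b set"
  where "cyclic_submodule R M x = (\<lambda>r. r \<odot>\<^bsub>M\<^esub> x) ` carrier R"

text \<open>The product \<open>I N\<close> of an ideal and a submodule is the submodule generated by the products
  \<open>i n\<close> (equivalently, the set of their finite sums), not merely the set of these products.\<close>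

definition ideal_submodule_prod ::
    "('a, 'c) ring_scheme \<Rightarrow> ('a, 'b, 'd) module_scheme \<Rightarrow> 'a set \<Rightarrow> 'b set \<Rightarrow> 'b set"
  where "ideal_submodule_prod R M I N =
    \<Inter>{H. submodule H R M \<and> {i \<odot>\<^bsub>M\<^esub> n | i n. i \<in> I \<and> n \<in> N} \<subseteq> H}"

definition prime_submodule ::
    "('a, 'c) ring_scheme \<Rightarrow> ('a, 'b, 'd) module_scheme \<Rightarrow> 'b set \<Rightarrow> bool"
  where "prime_submodule R M P \<longleftrightarrow>
    submodule P R M \<and> P \<noteq> carrier M \<and>
    (\<forall>r \<in> carrier R. \<forall>y \<in> carrier M.
      r \<odot>\<^bsub>M\<^esub> y \<in> P \<longrightarrow> r \<in> submodule_colon R M P \<or> y \<in> P)"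

definition phi1_prime_submodule ::
    "('a, 'c) ring_scheme \<Rightarrow> ('a, 'b, 'd) module_scheme \<Rightarrow> 'b set \<Rightarrow> bool"
  where "phi1_prime_submodule R M P \<longleftrightarrow>
    submodule P R M \<and> P \<noteq> carrier M \<and>
    (\<forall>r \<in> carrier R. \<forall>y \<in> carrier M.
      r \<odot>\<^bsub>M\<^esub> y \<in> P - ideal_submodule_prod R M (submodule_colon R M P) P \<longrightarrow>
      r \<in> submodule_colon R M P \<or> y \<in> P)"

end

theory Submission
  imports Defs "HOL-Algebra.Ideal"
begin

text \<open>If \<open>r y \<in> R x\<close> with \<open>y \<notin> R x\<close> and \<open>r \<notin> (R x : M)\<close>, then
  \<open>r (y + x) \<in> R x\<close> and \<open>y + x \<notin> R x\<close> as well, so \<open>\<phi>\<^sub>1\<close>-primeness puts both \<open>r y\<close> and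
  \<open>r (y + x)\<close> into \<open>(R x : M) R x = (R x : M) x\<close>. Hence \<open>r x = s x\<close> for some
  \<open>s \<in> (R x : M)\<close>, and \<open>r = s\<close> because \<open>x\<close> has zero annihilator: a contradiction.\<close>

context module
begin

text \<open>The ideal property serves twice: absorption collapses the product (Rx : M) Rx to
  multiples of \<open>x\<close> by elements of the colon, and closure under differences gives the
  final contradiction.\<close>

lemma ideal_submodule_colon:
  assumes N: "submodule N R M"
  shows "ideal (submodule_colon R M N) R"
proof (rule idealI[OF R.ring_axioms])
  note N' = submoduleE[OF N]
  \<comment> \<open>Since the zero of \<open>R\<close> sends all of \<open>M\<close> to zero, this
    puts it into the colon, which is thus nonempty.\<close>
  have "\<zero>\<^bsub>M\<^esub> \<in> N"
    using subgroup.one_closed[OF submodule.axioms(1)[OF N]] by simp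
  then show "subgroup (submodule_colon R M N) (add_monoid R)"
    by (intro R.add.subgroupI)
      (auto simp: submodule_colon_def smult_l_distr smult_l_minus N' simp flip: a_inv_def)
next
  fix a r assume a: "a \<in> submodule_colon R M N" and r: "r \<in> carrier R"
  then show "r \<otimes> a \<in> submodule_colon R M N"
    by (auto simp: submodule_colon_def smult_assoc1 submoduleE[OF N])
  with a r show "a \<otimes> r \<in> submodule_colon R M N"
    by (simp add: submodule_colon_def R.m_comm)
qed

text \<open>The map sending \<open>r\<close> to \<open>r x\<close> is \<open>R\<close>-linear, so it
  carries ideals to submodules. The image \<open>I x\<close> is thus a candidate in the intersection
  that defines the product of \<open>I\<close> and \<open>R x\<close>.\<close>

lemma submodule_ideal_smult:
  assumes I: "ideal I R" and x: "x \<in> carrier M"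
  shows "submodule ((\<lambda>r. r \<odot>\<^bsub>M\<^esub> x) ` I) R M"
proof -
  interpret I: ideal I R by (rule I)
  show ?thesis
  proof (rule submoduleI)
    show "(\<lambda>r. r \<odot>\<^bsub>M\<^esub> x) ` I \<subseteq> carrier M"
      using x I.a_subset by auto
    show "\<zero>\<^bsub>M\<^esub> \<in> (\<lambda>r. r \<odot>\<^bsub>M\<^esub> x) ` I"
      by (rule image_eqI[of _ _ \<zero>]) (use x I.zero_closed in auto)
  next
    fix a assume "a \<in> (\<lambda>r. r \<odot>\<^bsub>M\<^esub> x) ` I"
    then obtain i where i: "i \<in> I" "a = i \<odot>\<^bsub>M\<^esub> x" by auto
    then show "\<ominus>\<^bsub>M\<^esub> a \<in> (\<lambda>r. r \<odot>\<^bsub>M\<^esub> x) ` I"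
      by (intro image_eqI[of _ _ "\<ominus> i"]) (use x in \<open>auto simp: smult_l_minus\<close>)
  next
    fix a b assume "a \<in> (\<lambda>r. r \<odot>\<^bsub>M\<^esub> x) ` I" "b \<in> (\<lambda>r. r \<odot>\<^bsub>M\<^esub> x) ` I"
    then obtain i j where "i \<in> I" "a = i \<odot>\<^bsub>M\<^esub> x" "j \<in> I" "b = j \<odot>\<^bsub>M\<^esub> x" by auto
    then show "a \<oplus>\<^bsub>M\<^esub> b \<in> (\<lambda>r. r \<odot>\<^bsub>M\<^esub> x) ` I"
      by (intro image_eqI[of _ _ "i \<oplus> j"]) (use x in \<open>auto simp: smult_l_distr\<close>)
  next
    fix r a assume r: "r \<in> carrier R" and "a \<in> (\<lambda>r. r \<odot>\<^bsub>M\<^esub> x) ` I"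
    then obtain i where "i \<in> I" "a = i \<odot>\<^bsub>M\<^esub> x" by auto
    with r show "r \<odot>\<^bsub>M\<^esub> a \<in> (\<lambda>r. r \<odot>\<^bsub>M\<^esub> x) ` I"
      by (intro image_eqI[of _ _ "r \<otimes> i"]) (use x in \<open>auto simp: smult_assoc1 I.I_l_closed\<close>)
  qed
qed

text \<open>Because i (t x) = (i t) x with \<open>i t\<close> in \<open>I\<close>, the submodule
  \<open>I x\<close> contains all generators of the product. An element of the product is therefore
  a single multiple of \<open>x\<close>, not just a finite sum.\<close>

lemma ideal_cyclic_submodule_prod_subset:
  assumes I: "ideal I R" and x: "x \<in> carrier M"
  shows "ideal_submodule_prod R M I (cyclic_submodule R M x) \<subseteq> (\<lambda>r. r \<odot>\<^bsub>M\<^esub> x) ` I"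
proof -
  interpret I: ideal I R by (rule I)
  have "i \<odot>\<^bsub>M\<^esub> (t \<odot>\<^bsub>M\<^esub> x) \<in> (\<lambda>r. r \<odot>\<^bsub>M\<^esub> x) ` I" if "i \<in> I" "t \<in> carrier R" for i t
    using that x by (intro image_eqI[of _ _ "i \<otimes> t"]) (auto simp: smult_assoc1 I.I_r_closed)
  then show ?thesis
    unfolding ideal_submodule_prod_def cyclic_submodule_def
    using submodule_ideal_smult[OF I x] by (intro Inter_lower) auto
qed

lemma smult_right_cancel:
  assumes ann: "elt_annihilator R M x = {\<zero>}" and x: "x \<in> carrier M"
    and a: "a \<in> carrier R" and b: "b \<in> carrier R" and eq: "a \<odot>\<^bsub>M\<^esub> x = b \<odot>\<^bsub>M\<^esub> x"
  shows "a = b"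
proof -
  have "(a \<ominus> b) \<odot>\<^bsub>M\<^esub> x = \<zero>\<^bsub>M\<^esub>"
    using x a b eq by (simp add: R.minus_eq smult_l_distr smult_l_minus M.r_neg)
  then have "a \<ominus> b \<in> elt_annihilator R M x"
    using a b by (simp add: elt_annihilator_def)
  then have "a \<ominus> b = \<zero>" using ann by simp
  \<comment> \<open>By uniqueness of additive inverses, \<open>a\<close> is the inverse of
    \<open>-b\<close>, which is \<open>b\<close>.\<close>
  then show ?thesis using R.minus_equality[of a "\<ominus> b"] a b by (simp add: R.minus_eq)
qed

lemma prime_cyclic_submodule_if_phi1_prime:
  assumes x: "x \<in> carrier M" and ann: "elt_annihilator R M x = {\<zero>}"
    and phi1: "phi1_prime_submodule R M (cyclic_submodule R M x)"
  shows "prime_submodule R M (cyclic_submodule R M x)"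
proof -
  define P where "P = cyclic_submodule R M x"
  define I where "I = submodule_colon R M P"
  have P: "submodule P R M" and P_proper: "P \<noteq> carrier M"
    and P_phi1: "\<And>r y. \<lbrakk>r \<in> carrier R; y \<in> carrier M; r \<odot>\<^bsub>M\<^esub> y \<in> P; r \<notin> I; y \<notin> P\<rbrakk>
      \<Longrightarrow> r \<odot>\<^bsub>M\<^esub> y \<in> ideal_submodule_prod R M I P"
    using phi1 unfolding phi1_prime_submodule_def P_def I_def by blast+
  interpret I: ideal I R
    unfolding I_def by (rule ideal_submodule_colon[OF P])
  have prod: "\<exists>s\<in>I. z = s \<odot>\<^bsub>M\<^esub> x" if "z \<in> ideal_submodule_prod R M I P" for z
    using that ideal_cyclic_submodule_prod_subset[OF I.ideal_axioms x] unfolding P_def by blast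
  have rx_in: "r \<odot>\<^bsub>M\<^esub> x \<in> P" if "r \<in> carrier R" for r
    using that by (auto simp: P_def cyclic_submodule_def)
  have x_in: "x \<in> P" using rx_in[of \<one>] x by simp
  have "r \<in> I \<or> y \<in> P" if r: "r \<in> carrier R" and y: "y \<in> carrier M" and ry: "r \<odot>\<^bsub>M\<^esub> y \<in> P" for r y
  proof (rule ccontr)
    assume "\<not> (r \<in> I \<or> y \<in> P)"
    then have rI: "r \<notin> I" and yP: "y \<notin> P" by auto
    \<comment> \<open>Shifting \<open>y\<close> by \<open>x\<close> keeps it outside
      \<open>P\<close>, so the hypothesis applies to a second element, whose product with
      \<open>r\<close> differs from \<open>r y\<close> by exactly \<open>r x\<close>.\<close>
    have yx: "y \<oplus>\<^bsub>M\<^esub> x \<notin> P"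
    proof
      assume "y \<oplus>\<^bsub>M\<^esub> x \<in> P"
      then have "(y \<oplus>\<^bsub>M\<^esub> x) \<oplus>\<^bsub>M\<^esub> \<ominus>\<^bsub>M\<^esub> x \<in> P"
        using submoduleE(3,5)[OF P] x_in by blast
      with yP x y show False by (simp add: M.a_assoc M.r_neg)
    qed
    have ryx: "r \<odot>\<^bsub>M\<^esub> (y \<oplus>\<^bsub>M\<^esub> x) = r \<odot>\<^bsub>M\<^esub> y \<oplus>\<^bsub>M\<^esub> r \<odot>\<^bsub>M\<^esub> x"
      using r x y by (simp add: smult_r_distr)
    then have "r \<odot>\<^bsub>M\<^esub> (y \<oplus>\<^bsub>M\<^esub> x) \<in> P"
      using submoduleE(5)[OF P ry rx_in[OF r]] by simp
    then obtain s where s: "s \<in> I" "r \<odot>\<^bsub>M\<^esub> (y \<oplus>\<^bsub>M\<^esub> x) = s \<odot>\<^bsub>M\<^esub> x"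
      using prod P_phi1[OF r _ _ rI yx] x y by blast
    obtain t where t: "t \<in> I" "r \<odot>\<^bsub>M\<^esub> y = t \<odot>\<^bsub>M\<^esub> x"
      using prod P_phi1[OF r y ry rI yP] by blast
    note st = I.Icarr[OF s(1)] I.Icarr[OF t(1)]
    \<comment> \<open>Replacing \<open>r y\<close> by \<open>t x\<close> eliminates \<open>y\<close>
      and leaves an equation between multiples of \<open>x\<close>, where cancellation applies. The
      difference \<open>s - t\<close> is the element of the colon that equals
      \<open>r\<close>.\<close>
    have "(t \<oplus> r) \<odot>\<^bsub>M\<^esub> x = s \<odot>\<^bsub>M\<^esub> x"
      using s(2) t(2) ryx r x st by (simp add: smult_l_distr)
    then have "t \<oplus> r = s"
      using smult_right_cancel[OF ann x] r st by simp
    with R.r_neg1[OF st(2) r] have "\<ominus> t \<oplus> s = r" by simp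
    moreover have "\<ominus> t \<oplus> s \<in> I" using s(1) t(1) by simp
    ultimately have "r \<in> I" by simp
    with rI show False ..
  qed
  then show ?thesis
    using P P_proper unfolding prime_submodule_def P_def I_def by blast
qed

end

theorem theorem2p7:
  fixes R :: "('a, 'c) ring_scheme" and M :: "('a, 'b, 'd) module_scheme" and x :: 'b
  assumes "cring R" and "\<one>\<^bsub>R\<^esub> \<noteq> \<zero>\<^bsub>R\<^esub>"
    and "module R M"
    and "x \<in> carrier M" and "x \<noteq> \<zero>\<^bsub>M\<^esub>"
    and "cyclic_submodule R M x \<noteq> carrier M"
    and "elt_annihilator R M x = {\<zero>\<^bsub>R\<^esub>}"
    and "\<not> prime_submodule R M (cyclic_submodule R M x)"
  shows "\<not> phi1_prime_submodule R M (cyclic_submodule R M x)"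
  using module.prime_cyclic_submodule_if_phi1_prime[OF assms(3,4,7)] assms(8) by blast

end
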